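(* Let $X$ be an irreducible shift of finite type, let $Y$ be a shift of finite type, and let $\pi:X\to Y$ be a factor code. If $\pi$ is right class-closing, then $\pi$ is right continuing.
   Context: A shift space over a finite alphabet $\mathcal{A}$ is a closed shift-invariant subset of $\mathcal{A}^{\mathbb{Z}}$ (product topology), with shift map $\sigma(x)|_i=x|_{i+1}$. $\mathcal{B}(X)$ is the set of words occurring in points of $X$; $X$ is irreducible if for all $u,v\in\mathcal{B}(X)$ there is $w$ with $uwv\in\mathcal{B}(X)$. $X$ is a shift of finite type if for some $k\ge 0$ every word $w\in\mathcal{B}(X)$ of length $k$ satisfies: $uw,wv\in\mathcal{B}(X)$ implies $uwv\in\mathcal{B}(X)$. A factor code is a continuous surjective map between shift spaces commuting with $\sigma$. Two points $x,x'$ are left asymptotic if $x|_{(-\infty,n]}=x'|_{(-\infty,n]}$ for some $n\in\mathbb{Z}$. Right equivalence. Let $x,x'\in X$ with $\pi(x)=\pi(x')$. For $m\in\mathbb{Z}$, a right $m$-bridge from $x$ to $x'$ is a point $z\in X$ with $\pi(z)=\pi(x)=\pi(x')$ such that for some $n>m$, $z|_{(-\infty,m]}=x|_{(-\infty,m]}$ and $z|_{[n,\infty)}=x'|_{[n,\infty)}$. Write $x\to^r x'$ if for every $m\in\mathbb{Z}$ there is a right $m$-bridge from $x$ to $x'$. The points $x,x'$ are right equivalent ($x\sim^r x'$) if $x\to^r x'$ and $x'\to^r x$. Right class-closing: $\pi$ is right class-closing if any two left asymptotic points $x,x'\in X$ with $\pi(x)=\pi(x')$ are right equivalent. Right continuing: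 $\pi$ is right continuing if for all $x\in X$ and all $y\in Y$ left asymptotic to $\pi(x)$ there is $x'\in\pi^{-1}(y)$ left asymptotic to $x$. *)

theory Defs
  imports "HOL-Analysis.Analysis"
begin

definition shift_map :: "(int \<Rightarrow> 'a) \<Rightarrow> (int \<Rightarrow> 'a)" where
  "shift_map x = (\<lambda>i. x (i + 1))"

definition full_shift_topology :: "'a set \<Rightarrow> (int \<Rightarrow> 'a) topology" where
  "full_shift_topology A = product_topology (\<lambda>_. discrete_topology A) UNIV"

text \<open>Shift-invariance is two-sided, that is, \<open>X\<close> equals its image under the shift map.\<close>

definition shift_space :: "'a set \<Rightarrow> (int \<Rightarrow> 'a) set \<Rightarrow> bool" where
  "shift_space A X \<longleftrightarrow>
     finite A \<and> closedin (full_shift_topology A) X \<and> shift_map ` X = X"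

definition subword :: "(int \<Rightarrow> 'a) \<Rightarrow> int \<Rightarrow> nat \<Rightarrow> 'a list" where
  "subword x i n = map (\<lambda>j. x (i + int j)) [0..<n]"

definition language :: "(int \<Rightarrow> 'a) set \<Rightarrow> 'a list set" where
  "language X = {subword x i n | x i n. x \<in> X}"

definition irreducible_shift :: "(int \<Rightarrow> 'a) set \<Rightarrow> bool" where
  "irreducible_shift X \<longleftrightarrow>
     (\<forall>u \<in> language X. \<forall>v \<in> language X. \<exists>w. u @ w @ v \<in> language X)"

definition shift_of_finite_type :: "'a set \<Rightarrow> (int \<Rightarrow> 'a) set \<Rightarrow> bool" where
  "shift_of_finite_type A X \<longleftrightarrow>
     shift_space A X \<and>
     (\<exists>k. \<forall>w \<in> language X. length w = k \<longrightarrow>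
        (\<forall>u v. u @ w \<in> language X \<and> w @ v \<in> language X \<longrightarrow> u @ w @ v \<in> language X))"

definition factor_code ::
  "'a set \<Rightarrow> (int \<Rightarrow> 'a) set \<Rightarrow> 'b set \<Rightarrow> (int \<Rightarrow> 'b) set
    \<Rightarrow> ((int \<Rightarrow> 'a) \<Rightarrow> (int \<Rightarrow> 'b)) \<Rightarrow> bool" where
  "factor_code A X B Y \<pi> \<longleftrightarrow>
     shift_space A X \<and> shift_space B Y \<and>
     continuous_map (subtopology (full_shift_topology A) X)
                    (subtopology (full_shift_topology B) Y) \<pi> \<and>
     \<pi> ` X = Y \<and>
     (\<forall>x \<in> X. \<pi> (shift_map x) = shift_map (\<pi> x))"

definition left_asymptotic :: "(int \<Rightarrow> 'a) \<Rightarrow> (int \<Rightarrow> 'a) \<Rightarrow> bool" where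
  "left_asymptotic x x' \<longleftrightarrow> (\<exists>n. \<forall>i\<le>n. x i = x' i)"

definition right_bridge ::
  "(int \<Rightarrow> 'a) set \<Rightarrow> ((int \<Rightarrow> 'a) \<Rightarrow> (int \<Rightarrow> 'b)) \<Rightarrow> int
    \<Rightarrow> (int \<Rightarrow> 'a) \<Rightarrow> (int \<Rightarrow> 'a) \<Rightarrow> (int \<Rightarrow> 'a) \<Rightarrow> bool" where
  "right_bridge X \<pi> m x x' z \<longleftrightarrow>
     z \<in> X \<and> \<pi> z = \<pi> x \<and> \<pi> z = \<pi> x' \<and>
     (\<exists>n>m. (\<forall>i\<le>m. z i = x i) \<and> (\<forall>i\<ge>n. z i = x' i))"

definition right_reaches ::
  "(int \<Rightarrow> 'a) set \<Rightarrow> ((int \<Rightarrow> 'a) \<Rightarrow> (int \<Rightarrow> 'b))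
    \<Rightarrow> (int \<Rightarrow> 'a) \<Rightarrow> (int \<Rightarrow> 'a) \<Rightarrow> bool" where
  "right_reaches X \<pi> x x' \<longleftrightarrow> (\<forall>m. \<exists>z. right_bridge X \<pi> m x x' z)"

definition right_equivalent ::
  "(int \<Rightarrow> 'a) set \<Rightarrow> ((int \<Rightarrow> 'a) \<Rightarrow> (int \<Rightarrow> 'b))
    \<Rightarrow> (int \<Rightarrow> 'a) \<Rightarrow> (int \<Rightarrow> 'a) \<Rightarrow> bool" where
  "right_equivalent X \<pi> x x' \<longleftrightarrow> right_reaches X \<pi> x x' \<and> right_reaches X \<pi> x' x"

definition right_class_closing ::
  "(int \<Rightarrow> 'a) set \<Rightarrow> ((int \<Rightarrow> 'a) \<Rightarrow> (int \<Rightarrow> 'b)) \<Rightarrow> bool" where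
  "right_class_closing X \<pi> \<longleftrightarrow>
     (\<forall>x \<in> X. \<forall>x' \<in> X. left_asymptotic x x' \<and> \<pi> x = \<pi> x' \<longrightarrow> right_equivalent X \<pi> x x')"

definition right_continuing ::
  "(int \<Rightarrow> 'a) set \<Rightarrow> (int \<Rightarrow> 'b) set \<Rightarrow> ((int \<Rightarrow> 'a) \<Rightarrow> (int \<Rightarrow> 'b)) \<Rightarrow> bool" where
  "right_continuing X Y \<pi> \<longleftrightarrow>
     (\<forall>x \<in> X. \<forall>y \<in> Y. left_asymptotic y (\<pi> x) \<longrightarrow>
        (\<exists>x' \<in> X. \<pi> x' = y \<and> left_asymptotic x' x))"

end

theory Submission
  imports Defs
begin

text \<open>The proof compares numbers of right equivalence classes in fibres of \<open>\<pi>\<close>. On a fibre, right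
equivalence is an equivalence relation with boundedly many classes (\<open>card_separated_le\<close>), and
class-closing says that left asymptotic points of a fibre are in one class.

Choose \<open>y0\<close> whose fibre has the least number of classes, and representatives \<open>S\<close> of these classes.
By compactness a sufficiently long central block of \<open>y0\<close> has the following property: every point
of \<open>X\<close> whose image shows this block can be changed near the block, with the same image, so that it
visits a fixed block of some member of \<open>S\<close> (\<open>routing_block\<close>). Now let \<open>y\<close> be left asymptotic to
\<open>\<pi> x\<close> and let their common left tail contain this transition block. Representatives of different
classes over \<open>y\<close> must use different members of \<open>S\<close>, since otherwise one could cross over from one
to the other, and class-closing would put them in the same class. There are at least as many classes
over \<open>y\<close> as members of \<open>S\<close>, so every member of \<open>S\<close> is used, in particular one through which \<open>x\<close> can
be routed. Crossing over there leads from the left tail of \<open>x\<close> to a point over \<open>y\<close>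
(\<open>lift_through_block\<close>).

A general \<open>x\<close> is the limit of points that show the transition block on the far left; they exist as
\<open>X\<close> is irreducible, and \<open>y\<close> can be modified accordingly as \<open>Y\<close> is of finite type. Lifts exist for
these, but they might separate from the approximating points earlier and earlier. This is excluded
by \<open>uniform_bridge\<close>: there is a constant \<open>D\<close> such that any lift can be exchanged for one that
separates only after the time \<open>- D\<close>. A limit of such lifts is a lift of \<open>y\<close> left asymptotic to
\<open>x\<close>.\<close>

section \<open>Translating and joining points\<close>

definition translate :: "int \<Rightarrow> (int \<Rightarrow> 'a) \<Rightarrow> (int \<Rightarrow> 'a)" where
  "translate t x = (\<lambda>i. x (i + t))"

definition join_at :: "int \<Rightarrow> (int \<Rightarrow> 'a) \<Rightarrow> (int \<Rightarrow> 'a) \<Rightarrow> (int \<Rightarrow> 'a)" where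
  "join_at i x x' = (\<lambda>j. if j < i then x j else x' j)"

lemma translate_apply [simp]: "translate t x i = x (i + t)"
  by (simp add: translate_def)

lemma translate_translate [simp]: "translate s (translate t x) = translate (s + t) x"
  by (simp add: translate_def fun_eq_iff add.assoc)

lemma translate_0 [simp]: "translate 0 x = x"
  by (simp add: translate_def)

lemma join_at_left [simp]: "j < i \<Longrightarrow> join_at i x x' j = x j"
  by (simp add: join_at_def)

lemma join_at_right [simp]: "i \<le> j \<Longrightarrow> join_at i x x' j = x' j"
  by (simp add: join_at_def)

lemma join_at_same [simp]: "join_at i x x = x"
  by (simp add: join_at_def)

lemma length_subword [simp]: "length (subword x i n) = n"
  by (simp add: subword_def)

lemma nth_subword [simp]: "j < n \<Longrightarrow> subword x i n ! j = x (i + int j)"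
  by (simp add: subword_def)

lemma subword_append: "subword x i (m + n) = subword x i m @ subword x (i + int m) n"
  by (rule nth_equalityI) (auto simp: nth_append algebra_simps)

lemma subword_eq_iff:
  "subword x i n = subword x' i' n \<longleftrightarrow> (\<forall>j\<in>{0..<int n}. x (i + j) = x' (i' + j))"
proof
  assume eq: "subword x i n = subword x' i' n"
  show "\<forall>j\<in>{0..<int n}. x (i + j) = x' (i' + j)"
  proof
    fix j assume j: "j \<in> {0..<int n}"
    then have "subword x i n ! nat j = subword x' i' n ! nat j" by (simp add: eq)
    moreover have "nat j < n" using j by auto
    ultimately show "x (i + j) = x' (i' + j)" using j by simp
  qed
next
  assume "\<forall>j\<in>{0..<int n}. x (i + j) = x' (i' + j)"
  then show "subword x i n = subword x' i' n"
    by (intro nth_equalityI) auto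
qed

section \<open>Windows and compactness\<close>

lemma topspace_full_shift: "topspace (full_shift_topology A) = {x. \<forall>i. x i \<in> A}"
  by (auto simp: full_shift_topology_def PiE_def)

text \<open>Only finitely many coordinates of a basic open set are constrained, so some symmetric
window \<open>{-N..N}\<close> contains all of them. Together with the openness of cylinders this turns
statements about the product topology into statements about agreement on windows.\<close>

lemma full_shift_open_window:
  assumes "openin (full_shift_topology A) U" "x \<in> U"
  shows "\<exists>N::nat. \<forall>p. (\<forall>i. p i \<in> A) \<longrightarrow> (\<forall>j\<in>{- int N..int N}. p j = x j) \<longrightarrow> p \<in> U"
proof -
  obtain V where fin: "finite {i. V i \<noteq> A}" and xV: "x \<in> Pi\<^sub>E UNIV V" and VU: "Pi\<^sub>E UNIV V \<subseteq> U"
    using assms unfolding full_shift_topology_def openin_product_topology_alt by auto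
  have "finite ((\<lambda>i. nat \<bar>i\<bar>) ` {i. V i \<noteq> A})" using fin by simp
  then obtain N where N: "\<And>i. V i \<noteq> A \<Longrightarrow> nat \<bar>i\<bar> \<le> N"
    unfolding finite_nat_set_iff_bounded_le by auto
  show ?thesis
  proof (intro exI[of _ N] allI impI)
    fix p assume pA: "\<forall>i. p i \<in> A" and p: "\<forall>j\<in>{- int N..int N}. p j = x j"
    have "p i \<in> V i" for i
    proof (cases "V i = A")
      case False
      then have "i \<in> {- int N..int N}" using N[of i] by auto
      then have "p i = x i" using p by blast
      then show ?thesis using xV by auto
    qed (use pA in auto)
    then show "p \<in> U" using VU by auto
  qed
qed

lemma openin_full_shift_cylinder:
  assumes "\<forall>i. x i \<in> A"
  shows "openin (full_shift_topology A) {p. (\<forall>i. p i \<in> A) \<and> (\<forall>j\<in>{- int N..int N}. p j = x j)}"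
proof -
  let ?V = "\<lambda>i. if i \<in> {- int N..int N} then {x i} else A"
  have "finite {i. ?V i \<noteq> A}"
    by (rule finite_subset[of _ "{- int N..int N}"]) auto
  then have "openin (full_shift_topology A) (Pi\<^sub>E UNIV ?V)"
    unfolding full_shift_topology_def openin_PiE_gen using assms
    by auto
  also have "Pi\<^sub>E UNIV ?V = {p. (\<forall>i. p i \<in> A) \<and> (\<forall>j\<in>{- int N..int N}. p j = x j)}"
    using assms by (auto simp: PiE_iff split: if_splits)
  finally show ?thesis .
qed

lemma shift_space_in_alphabet:
  assumes "shift_space A X" "x \<in> X" shows "x i \<in> A"
  using assms closedin_subset unfolding shift_space_def topspace_full_shift[symmetric]
  by (fastforce simp: topspace_full_shift)

lemma shift_space_limit:
  assumes "shift_space A X" and lim: "\<And>N::nat. \<exists>p\<in>X. \<forall>j\<in>{- int N..int N}. p j = x j"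
  shows "x \<in> X"
proof -
  have cl: "closedin (full_shift_topology A) X" using assms by (simp add: shift_space_def)
  have xA: "x i \<in> A" for i
  proof -
    obtain p where "p \<in> X" "\<forall>j\<in>{- int (nat \<bar>i\<bar>)..int (nat \<bar>i\<bar>)}. p j = x j"
      using lim by blast
    moreover have "i \<in> {- int (nat \<bar>i\<bar>)..int (nat \<bar>i\<bar>)}" by auto
    ultimately have "p i = x i" by blast
    then show ?thesis using shift_space_in_alphabet[OF assms(1) \<open>p \<in> X\<close>] by metis
  qed
  have "x \<in> full_shift_topology A closure_of X"
    unfolding in_closure_of
  proof (intro conjI allI impI)
    show "x \<in> topspace (full_shift_topology A)" using xA by (simp add: topspace_full_shift)
    fix T assume T: "x \<in> T \<and> openin (full_shift_topology A) T"
    obtain N :: nat where N: "\<And>p. (\<forall>i. p i \<in> A) \<Longrightarrow> (\<forall>j\<in>{- int N..int N}. p j = x j) \<Longrightarrow> p \<in> T"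
      using full_shift_open_window[of A T x] T by blast
    obtain p where "p \<in> X" "\<forall>j\<in>{- int N..int N}. p j = x j" using lim by blast
    then show "\<exists>y. y \<in> X \<and> y \<in> T"
      using N shift_space_in_alphabet[OF assms(1)] by blast
  qed
  then show ?thesis using cl by (simp add: closure_of_closedin)
qed

text \<open>The full shift over a finite alphabet is compact, so the closures of the tails of the
sequence have a common point.\<close>

lemma full_shift_cluster_point:
  fixes s :: "nat \<Rightarrow> int \<Rightarrow> 'a"
  assumes "finite A" and sA: "\<And>n i. s n i \<in> A"
  shows "\<exists>x. \<forall>N n. \<exists>m\<ge>n. \<forall>j\<in>{- int N..int N}. s m j = x j"
proof -
  let ?T = "full_shift_topology A"
  let ?F = "\<lambda>n. ?T closure_of (s ` {n..})"
  have comp: "compact_space ?T"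
    unfolding full_shift_topology_def compact_space_product_topology
    using assms(1) by (simp add: compact_space_discrete_topology)
  have sub: "s ` {n..} \<subseteq> topspace ?T" for n
    using sA by (auto simp: topspace_full_shift)
  have "(\<Inter>n. ?F n) \<noteq> {}"
  proof (rule compact_space_imp_nest[OF comp])
    show "closedin ?T (?F n)" for n by simp
    show "?F n \<noteq> {}" for n
      using closure_of_subset[OF sub[of n]] by auto
    show "decseq ?F"
      by (intro antimonoI closure_of_mono image_mono) auto
  qed
  then obtain x where x: "\<And>n. x \<in> ?F n" by auto
  have xA: "\<forall>i. x i \<in> A"
    using x[of 0] in_closure_of[of x ?T] by (auto simp: topspace_full_shift)
  show ?thesis
  proof (intro exI[of _ x] allI)
    fix N n
    let ?C = "{p. (\<forall>i. p i \<in> A) \<and> (\<forall>j\<in>{- int N..int N}. p j = x j)}"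
    have "x \<in> ?C" using xA by simp
    then have "\<exists>y. y \<in> s ` {n..} \<and> y \<in> ?C"
      using x[of n] openin_full_shift_cylinder[OF xA, of N] unfolding in_closure_of by meson
    then show "\<exists>m\<ge>n. \<forall>j\<in>{- int N..int N}. s m j = x j" by auto
  qed
qed

lemma full_shift_convergent_subsequence:
  fixes s :: "nat \<Rightarrow> int \<Rightarrow> 'a"
  assumes "finite A" and "\<And>n i. s n i \<in> A"
  shows "\<exists>x \<phi>. strict_mono (\<phi> :: nat \<Rightarrow> nat) \<and> (\<forall>n. \<forall>j\<in>{- int n..int n}. s (\<phi> n) j = x j)"
proof -
  obtain x where x: "\<And>N n. \<exists>m\<ge>n. \<forall>j\<in>{- int N..int N}. s m j = x j"
    using full_shift_cluster_point[of A s] assms by blast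
  have "\<exists>\<phi>. \<forall>n. (\<forall>j\<in>{- int n..int n}. s (\<phi> n) j = x j) \<and> \<phi> n < \<phi> (Suc n)"
  proof (rule dependent_nat_choice)
    show "\<exists>m. \<forall>j\<in>{- int 0..int 0}. s m j = x j" using x by blast
    show "\<exists>m'. (\<forall>j\<in>{- int (Suc n)..int (Suc n)}. s m' j = x j) \<and> m < m'" for m n
      using x[of "Suc m" "Suc n"] by (meson Suc_le_eq)
  qed
  then show ?thesis by (metis strict_mono_Suc_iff)
qed

lemma shift_space_convergent_subsequence:
  assumes "shift_space A X" and s: "\<And>n. s n \<in> X"
  shows "\<exists>x\<in>X. \<exists>\<phi>. strict_mono (\<phi> :: nat \<Rightarrow> nat) \<and> (\<forall>n. \<forall>j\<in>{- int n..int n}. s (\<phi> n) j = x j)"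
proof -
  obtain x \<phi> where \<phi>: "strict_mono (\<phi> :: nat \<Rightarrow> nat)" "\<And>n. \<forall>j\<in>{- int n..int n}. s (\<phi> n) j = x j"
    using full_shift_convergent_subsequence[of A s] shift_space_in_alphabet[OF assms(1) s] assms(1)
    unfolding shift_space_def by blast
  have "x \<in> X" using shift_space_limit[OF assms(1)] \<phi>(2) s by meson
  then show ?thesis using \<phi> by blast
qed

section \<open>Invariance, joining, and locality of codes\<close>

lemma shift_map_eq_translate: "shift_map x = translate 1 x"
  by (simp add: shift_map_def translate_def)

lemma shift_space_translate_nat:
  assumes "shift_space A X"
  shows "x \<in> X \<Longrightarrow> translate (int n) x \<in> X \<and> translate (- int n) x \<in> X"
proof (induction n)
  case (Suc n)
  have img: "translate 1 ` X = X"
    using assms unfolding shift_space_def shift_map_eq_translate[abs_def] by simp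
  have "translate 1 (translate (int n) x) \<in> X" using img Suc by blast
  obtain p where p: "p \<in> X" "translate 1 p = translate (- int n) x"
    using img Suc by (metis imageE)
  have "p = translate (-1) (translate 1 p)" by simp
  also have "\<dots> = translate (- int (Suc n)) x" unfolding p(2) by simp
  finally have "translate (- int (Suc n)) x \<in> X" using p(1) by simp
  moreover have "translate 1 (translate (int n) x) = translate (int (Suc n)) x"
    by (simp only: translate_translate of_nat_Suc add.commute)
  ultimately show ?case using \<open>translate 1 (translate (int n) x) \<in> X\<close> by metis
qed simp

lemma shift_space_translate:
  assumes "shift_space A X" "x \<in> X" shows "translate t x \<in> X"
  using shift_space_translate_nat[OF assms, of "nat \<bar>t\<bar>"]
  by (cases "t \<ge> 0") auto

lemma factor_code_translate:
  assumes fc: "factor_code A X B Y \<pi>" and "x \<in> X"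
  shows "\<pi> (translate t x) = translate t (\<pi> x)"
proof -
  have X: "shift_space A X" using fc by (simp add: factor_code_def)
  have one: "\<pi> (translate 1 p) = translate 1 (\<pi> p)" if "p \<in> X" for p
    using fc that unfolding factor_code_def shift_map_eq_translate by blast
  have pos: "\<pi> (translate (int n) p) = translate (int n) (\<pi> p)" if "p \<in> X" for p n
    using that
  proof (induction n arbitrary: p)
    case (Suc n)
    have "\<pi> (translate (int (Suc n)) p) = \<pi> (translate (int n) (translate 1 p))"
      by (simp only: translate_translate of_nat_Suc add.commute)
    also have "\<dots> = translate (int n) (\<pi> (translate 1 p))"
      by (rule Suc.IH) (rule shift_space_translate[OF X Suc.prems])
    also have "\<dots> = translate (int n) (translate 1 (\<pi> p))" by (simp only: one[OF Suc.prems])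
    also have "\<dots> = translate (int (Suc n)) (\<pi> p)"
      by (simp only: translate_translate of_nat_Suc add.commute)
    finally show ?case .
  qed simp
  show ?thesis
  proof (cases "t \<ge> 0")
    case True
    then show ?thesis using pos[OF assms(2), of "nat t"] by simp
  next
    case False
    have "translate t (\<pi> x) = translate t (\<pi> (translate (int (nat (- t))) (translate t x)))"
      using False by simp
    also have "\<dots> = translate t (translate (int (nat (- t))) (\<pi> (translate t x)))"
      by (simp only: pos[OF shift_space_translate[OF X assms(2)]])
    also have "\<dots> = \<pi> (translate t x)"
      using False by simp
    finally show ?thesis by simp
  qed
qed

text \<open>Every long window of the joined point is a word \<open>uwv\<close> in which \<open>w\<close> is the common block of length
\<open>k\<close>, \<open>uw\<close> occurs in \<open>x\<close>, and \<open>wv\<close> occurs in \<open>x'\<close>. The finite type condition puts \<open>uwv\<close> in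
the language, and a closed set containing arbitrarily good approximations of a point contains the
point.\<close>

lemma sft_join:
  assumes "shift_of_finite_type A X"
  shows "\<exists>k::nat. \<forall>x\<in>X. \<forall>x'\<in>X. \<forall>i. (\<forall>j\<in>{i..<i + int k}. x j = x' j) \<longrightarrow> join_at i x x' \<in> X"
proof -
  have ss: "shift_space A X" using assms by (simp add: shift_of_finite_type_def)
  obtain k where k: "\<And>w u v. \<lbrakk>w \<in> language X; length w = k; u @ w \<in> language X; w @ v \<in> language X\<rbrakk>
      \<Longrightarrow> u @ w @ v \<in> language X"
    using assms unfolding shift_of_finite_type_def by blast
  have "join_at i x x' \<in> X"
    if x: "x \<in> X" and x': "x' \<in> X" and eq: "\<forall>j\<in>{i..<i + int k}. x j = x' j" for x x' i
  proof (rule shift_space_limit[OF ss])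
    fix N :: nat
    define M where "M = Suc (nat \<bar>i\<bar> + N)"
    define a where "a = i - int M"
    let ?z = "join_at i x x'"
    let ?u = "subword x a M" and ?w = "subword x i k" and ?v = "subword x' (i + int k) M"
    have w': "?w = subword x' i k" using eq by (simp add: subword_eq_iff)
    have "?u @ ?w = subword x a (M + k)"
      unfolding subword_append by (simp add: a_def)
    moreover have "?w @ ?v = subword x' i (k + M)"
      unfolding subword_append w' by simp
    ultimately have "?u @ ?w @ ?v \<in> language X"
      using k[of ?w ?u ?v] x x' unfolding language_def by fastforce
    moreover have "?u @ ?w @ ?v = subword ?z a (M + (k + M))"
    proof -
      have "?u = subword ?z a M" unfolding subword_eq_iff by (auto simp: a_def)
      moreover have "?w = subword ?z (a + int M) k"
        unfolding w' unfolding subword_eq_iff by (auto simp: a_def)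
      moreover have "?v = subword ?z (a + int M + int k) M"
        unfolding subword_eq_iff by (auto simp: a_def)
      ultimately show ?thesis by (simp only: subword_append)
    qed
    ultimately obtain p b where p: "p \<in> X" and "subword ?z a (M + (k + M)) = subword p b (M + (k + M))"
      unfolding language_def by auto (metis length_subword)
    then have zp: "\<forall>j\<in>{0..<int (M + (k + M))}. ?z (a + j) = p (b + j)"
      by (simp only: subword_eq_iff)
    show "\<exists>p\<in>X. \<forall>j\<in>{- int N..int N}. p j = ?z j"
    proof (intro bexI ballI)
      show "translate (b - a) p \<in> X" using shift_space_translate[OF ss p] .
      fix j assume "j \<in> {- int N..int N}"
      then have "j - a \<in> {0..<int (M + (k + M))}"
        by (auto simp: a_def M_def)
      then show "translate (b - a) p j = ?z j"
        using zp by (metis add.commute add_diff_eq diff_add_cancel translate_apply)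
    qed
  qed
  then show ?thesis by blast
qed

text \<open>The Curtis--Hedlund--Lyndon theorem. Pairs of points agreeing on ever longer central windows but
with different image symbols at \<open>0\<close> would accumulate at a pair \<open>(x, x)\<close>, where \<open>\<pi>\<close> would be
discontinuous.\<close>

lemma factor_code_local:
  assumes fc: "factor_code A X B Y \<pi>"
  shows "\<exists>r::nat. \<forall>x\<in>X. \<forall>x'\<in>X. \<forall>i. (\<forall>j\<in>{i - int r..i + int r}. x j = x' j) \<longrightarrow> \<pi> x i = \<pi> x' i"
proof -
  have X: "shift_space A X" and Y: "shift_space B Y" using fc by (auto simp: factor_code_def)
  have cont: "\<exists>N::nat. \<forall>p\<in>X. (\<forall>j\<in>{- int N..int N}. p j = x j) \<longrightarrow> \<pi> p 0 = \<pi> x 0" if x: "x \<in> X" for x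
  proof -
    let ?U = "{y. (\<forall>i. y i \<in> B) \<and> (\<forall>j\<in>{- int 0..int 0}. y j = \<pi> x j)}"
    have im: "\<pi> p \<in> Y" if "p \<in> X" for p using fc that by (auto simp: factor_code_def)
    have iB: "\<forall>i. \<pi> p i \<in> B" if "p \<in> X" for p
      using shift_space_in_alphabet[OF Y im[OF that]] by blast
    have sub: "topspace (full_shift_topology A) \<inter> X = X" "topspace (full_shift_topology B) \<inter> Y = Y"
      using shift_space_in_alphabet[OF X] shift_space_in_alphabet[OF Y]
      by (auto simp: topspace_full_shift)
    have "openin (subtopology (full_shift_topology B) Y) (?U \<inter> Y)"
      using openin_full_shift_cylinder[OF iB[OF x]] openin_subtopology by blast
    then have "openin (subtopology (full_shift_topology A) X) {p \<in> X. \<pi> p \<in> ?U \<inter> Y}"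
      using fc sub unfolding factor_code_def continuous_map by auto
    then obtain V where V: "openin (full_shift_topology A) V" "{p \<in> X. \<pi> p \<in> ?U \<inter> Y} = V \<inter> X"
      unfolding openin_subtopology by blast
    have "\<pi> x \<in> ?U \<inter> Y" using im[OF x] iB[OF x] by simp
    then have "x \<in> V" using V(2) x by blast
    then obtain N :: nat where N: "\<And>p. (\<forall>i. p i \<in> A) \<Longrightarrow> (\<forall>j\<in>{- int N..int N}. p j = x j) \<Longrightarrow> p \<in> V"
      using full_shift_open_window[OF V(1) \<open>x \<in> V\<close>] by blast
    show ?thesis
    proof (intro exI[of _ N] ballI impI)
      fix p assume "p \<in> X" "\<forall>j\<in>{- int N..int N}. p j = x j"
      then have "p \<in> V \<inter> X" using N shift_space_in_alphabet[OF X] by blast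
      then have "\<pi> p \<in> ?U" using V(2) by blast
      then show "\<pi> p 0 = \<pi> x 0" by simp
    qed
  qed
  have "\<exists>r::nat. \<forall>x\<in>X. \<forall>x'\<in>X. (\<forall>j\<in>{- int r..int r}. x j = x' j) \<longrightarrow> \<pi> x 0 = \<pi> x' 0"
  proof (rule ccontr)
    assume "\<not> ?thesis"
    then have "\<forall>r::nat. \<exists>x x'. x \<in> X \<and> x' \<in> X \<and> (\<forall>j\<in>{- int r..int r}. x j = x' j) \<and> \<pi> x 0 \<noteq> \<pi> x' 0"
      by blast
    then obtain s s' where s: "\<And>n::nat. s n \<in> X" "\<And>n. s' n \<in> X"
        "\<And>n. \<forall>j\<in>{- int n..int n}. s n j = s' n j" "\<And>n. \<pi> (s n) 0 \<noteq> \<pi> (s' n) 0"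
      by metis
    obtain x \<phi> where x: "x \<in> X" and \<phi>: "strict_mono (\<phi> :: nat \<Rightarrow> nat)"
        "\<And>n. \<forall>j\<in>{- int n..int n}. s (\<phi> n) j = x j"
      using shift_space_convergent_subsequence[OF X, of s] s(1) by blast
    obtain N :: nat where N: "\<And>p. p \<in> X \<Longrightarrow> (\<forall>j\<in>{- int N..int N}. p j = x j) \<Longrightarrow> \<pi> p 0 = \<pi> x 0"
      using cont[OF x] by blast
    have "N \<le> \<phi> N" using \<phi>(1) by (simp add: strict_mono_imp_increasing)
    then have "\<forall>j\<in>{- int N..int N}. s' (\<phi> N) j = x j"
      using s(3)[of "\<phi> N"] \<phi>(2)[of N] by auto
    then have "\<pi> (s' (\<phi> N)) 0 = \<pi> (s (\<phi> N)) 0" using N s \<phi>(2) by metis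
    then show False using s(4) by metis
  qed
  then obtain r :: nat where r: "\<And>x x'. \<lbrakk>x \<in> X; x' \<in> X; \<forall>j\<in>{- int r..int r}. x j = x' j\<rbrakk>
      \<Longrightarrow> \<pi> x 0 = \<pi> x' 0" by blast
  have "\<pi> x i = \<pi> x' i" if "x \<in> X" "x' \<in> X" "\<forall>j\<in>{i - int r..i + int r}. x j = x' j" for x x' i
  proof -
    have "\<pi> (translate i x) 0 = \<pi> (translate i x') 0"
    proof (rule r)
      show "translate i x \<in> X" "translate i x' \<in> X"
        using that(1,2) by (auto intro: shift_space_translate[OF X])
      show "\<forall>j\<in>{- int r..int r}. translate i x j = translate i x' j"
        using that(3) by simp
    qed
    then show ?thesis using factor_code_translate[OF fc] that(1,2) by simp
  qed
  then show ?thesis by blast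
qed

lemma shift_space_cluster_pair:
  assumes "shift_space A X" and s: "\<And>n::nat. s n \<in> X" and s': "\<And>n. s' n \<in> X"
  shows "\<exists>x\<in>X. \<exists>x'\<in>X. \<forall>N. \<exists>n\<ge>N. (\<forall>j\<in>{- int N..int N}. s n j = x j) \<and>
           (\<forall>j\<in>{- int N..int N}. s' n j = x' j)"
proof -
  obtain x \<phi> where x: "x \<in> X" and \<phi>: "strict_mono (\<phi> :: nat \<Rightarrow> nat)"
      "\<And>n. \<forall>j\<in>{- int n..int n}. s (\<phi> n) j = x j"
    using shift_space_convergent_subsequence[OF assms(1), of s] s by blast
  obtain x' \<psi> where x': "x' \<in> X" and \<psi>: "strict_mono (\<psi> :: nat \<Rightarrow> nat)"
      "\<And>n. \<forall>j\<in>{- int n..int n}. s' (\<phi> (\<psi> n)) j = x' j"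
    using shift_space_convergent_subsequence[OF assms(1), of "\<lambda>n. s' (\<phi> n)"] s' by blast
  have "\<exists>n\<ge>N. (\<forall>j\<in>{- int N..int N}. s n j = x j) \<and> (\<forall>j\<in>{- int N..int N}. s' n j = x' j)" for N
  proof (intro exI[of _ "\<phi> (\<psi> N)"] conjI ballI)
    have N: "N \<le> \<psi> N" using \<psi>(1) by (rule strict_mono_imp_increasing)
    also have "\<psi> N \<le> \<phi> (\<psi> N)" using \<phi>(1) by (rule strict_mono_imp_increasing)
    finally show "N \<le> \<phi> (\<psi> N)" .
    fix j assume j: "j \<in> {- int N..int N}"
    then have "j \<in> {- int (\<psi> N)..int (\<psi> N)}" using N by auto
    then show "s (\<phi> (\<psi> N)) j = x j" using \<phi>(2) by blast
    show "s' (\<phi> (\<psi> N)) j = x' j" using \<psi>(2) j by blast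
  qed
  then show ?thesis using x x' by blast
qed

text \<open>Irreducibility puts a word \<open>uwv\<close> into the language, where \<open>u\<close> and \<open>v\<close> are the central blocks
of \<open>p\<close> and \<open>x\<close>; the point showing it is shifted so that \<open>v\<close> is centred at the origin.\<close>

lemma irreducible_shift_connect:
  fixes N :: nat
  assumes ss: "shift_space A X" and irr: "irreducible_shift X" and p: "p \<in> X" and x: "x \<in> X"
  shows "\<exists>g\<in>X. \<exists>t. t + int N < - int N \<and> (\<forall>j\<in>{- int N..int N}. g (t + j) = p j) \<and>
           (\<forall>j\<in>{- int N..int N}. g j = x j)"
proof -
  let ?l = "2 * N + 1"
  have "subword p (- int N) ?l \<in> language X" "subword x (- int N) ?l \<in> language X"
    using p x unfolding language_def by blast+
  then obtain w where "subword p (- int N) ?l @ w @ subword x (- int N) ?l \<in> language X"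
    using irr unfolding irreducible_shift_def by blast
  then obtain h i n where h: "h \<in> X"
      and eq: "subword p (- int N) ?l @ w @ subword x (- int N) ?l = subword h i n"
    unfolding language_def by blast
  define c where "c = length w"
  have "n = ?l + (c + ?l)" using arg_cong[OF eq, of length] by (simp add: c_def)
  then have "subword p (- int N) ?l @ w @ subword x (- int N) ?l =
      subword h i ?l @ subword h (i + int ?l) c @ subword h (i + int ?l + int c) ?l"
    using eq by (simp only: subword_append)
  then have "subword p (- int N) ?l = subword h i ?l"
      "subword x (- int N) ?l = subword h (i + int ?l + int c) ?l"
    by (simp_all add: c_def del: of_nat_add)
  then have hp: "\<forall>j\<in>{0..<int ?l}. p (- int N + j) = h (i + j)"
    and hx: "\<forall>j\<in>{0..<int ?l}. x (- int N + j) = h (i + int ?l + int c + j)"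
    by (simp_all only: subword_eq_iff)
  define s where "s = i + int ?l + int c + int N"
  show ?thesis
  proof (intro bexI[of _ "translate s h"] exI[of _ "- int ?l - int c"] conjI ballI)
    show "translate s h \<in> X" by (rule shift_space_translate[OF ss h])
    show "- int ?l - int c + int N < - int N" by simp
    fix j assume "j \<in> {- int N..int N}"
    then have "j + int N \<in> {0..<int ?l}" by auto
    then have "p (- int N + (j + int N)) = h (i + (j + int N))"
        "x (- int N + (j + int N)) = h (i + int ?l + int c + (j + int N))"
      using hp hx by blast+
    then show "translate s h (- int ?l - int c + j) = p j" "translate s h j = x j"
      by (simp_all add: s_def algebra_simps)
  qed
qed

section \<open>Joining points and their images\<close>

text \<open>The number \<open>K\<close> is the overlap needed for joining two points, and \<open>r\<close> is the radius of \<open>\<pi>\<close> as a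
sliding block code. A larger overlap preserves the joining property, so \<open>2 * r \<le> K\<close> can be
arranged; it makes joining commute with the code, at the price of moving the joint by \<open>r\<close>.\<close>

locale sft_code =
  fixes A :: "'a set" and X :: "(int \<Rightarrow> 'a) set" and \<pi> :: "(int \<Rightarrow> 'a) \<Rightarrow> (int \<Rightarrow> 'b)"
    and K r :: nat
  assumes shift_space: "shift_space A X"
    and join_mem: "\<lbrakk>x \<in> X; x' \<in> X; \<forall>j\<in>{i..<i + int K}. x j = x' j\<rbrakk> \<Longrightarrow> join_at i x x' \<in> X"
    and code_translate: "x \<in> X \<Longrightarrow> \<pi> (translate t x) = translate t (\<pi> x)"
    and code_local: "\<lbrakk>x \<in> X; x' \<in> X; \<forall>j\<in>{i - int r..i + int r}. x j = x' j\<rbrakk> \<Longrightarrow> \<pi> x i = \<pi> x' i"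
    and radius_window: "2 * r \<le> K"
begin

lemma translate_mem: "x \<in> X \<Longrightarrow> translate t x \<in> X"
  by (rule shift_space_translate[OF shift_space])

text \<open>Because \<open>2 * r \<le> K\<close>, the window that determines an image symbol at \<open>j\<close> cannot stick out of the
common block on both sides: it lies to the left of \<open>i + K\<close>, where the joined point is \<open>x\<close>, or to the
right of \<open>i\<close>, where it is \<open>x'\<close>.\<close>

lemma code_join:
  assumes "x \<in> X" "x' \<in> X" and eq: "\<forall>j\<in>{i..<i + int K}. x j = x' j"
  shows "\<pi> (join_at i x x') = join_at (i + int r) (\<pi> x) (\<pi> x')"
proof
  fix j
  have z: "join_at i x x' \<in> X" by (rule join_mem[OF assms])
  have l: "join_at i x x' a = x a" if "a < i + int K" for a
    using that eq by (cases "a < i") auto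
  show "\<pi> (join_at i x x') j = join_at (i + int r) (\<pi> x) (\<pi> x') j"
  proof (cases "j < i + int r")
    case True
    then have "\<pi> (join_at i x x') j = \<pi> x j"
      using radius_window by (intro code_local z assms ballI l) auto
    then show ?thesis using True by simp
  next
    case False
    then have "\<pi> (join_at i x x') j = \<pi> x' j"
      by (intro code_local z assms) auto
    then show ?thesis using False by simp
  qed
qed

lemma code_agree:
  assumes "x \<in> X" "x' \<in> X" "\<forall>j\<in>{- int (N + r)..int (N + r)}. x j = x' j"
  shows "\<forall>j\<in>{- int N..int N}. \<pi> x j = \<pi> x' j"
proof
  fix j assume "j \<in> {- int N..int N}"
  then have "{j - int r..j + int r} \<subseteq> {- int (N + r)..int (N + r)}" by auto
  then show "\<pi> x j = \<pi> x' j" using assms by (intro code_local) blast+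
qed

lemma cluster_pair:
  assumes s: "\<And>n::nat. s n \<in> X" and s': "\<And>n. s' n \<in> X"
  shows "\<exists>x\<in>X. \<exists>x'\<in>X. \<forall>N. \<exists>n\<ge>N. \<forall>j\<in>{- int N..int N}.
           s n j = x j \<and> \<pi> (s n) j = \<pi> x j \<and> s' n j = x' j \<and> \<pi> (s' n) j = \<pi> x' j"
proof -
  obtain x x' where x: "x \<in> X" "x' \<in> X" and lim: "\<And>N. \<exists>n\<ge>N. (\<forall>j\<in>{- int N..int N}. s n j = x j) \<and>
           (\<forall>j\<in>{- int N..int N}. s' n j = x' j)"
    using shift_space_cluster_pair[OF shift_space, of s s'] s s' by blast
  have "\<exists>n\<ge>N. \<forall>j\<in>{- int N..int N}.
           s n j = x j \<and> \<pi> (s n) j = \<pi> x j \<and> s' n j = x' j \<and> \<pi> (s' n) j = \<pi> x' j" for N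
  proof -
    obtain n where n: "n \<ge> N + r" and eq: "\<forall>j\<in>{- int (N + r)..int (N + r)}. s n j = x j"
        "\<forall>j\<in>{- int (N + r)..int (N + r)}. s' n j = x' j"
      using lim by blast
    have "{- int N..int N} \<subseteq> {- int (N + r)..int (N + r)}" by auto
    then show ?thesis
      using n eq code_agree[OF s x(1) eq(1)] code_agree[OF s' x(2) eq(2)]
      by (intro exI[of _ n]) auto
  qed
  then show ?thesis using x by blast
qed

lemma cluster_point:
  assumes "\<And>n::nat. s n \<in> X"
  shows "\<exists>x\<in>X. \<forall>N. \<exists>n\<ge>N. \<forall>j\<in>{- int N..int N}. s n j = x j \<and> \<pi> (s n) j = \<pi> x j"
  using cluster_pair[of s s] assms by meson

section \<open>Right classes of a fibre\<close>

lemma right_reaches_refl: "x \<in> X \<Longrightarrow> right_reaches X \<pi> x x"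
  unfolding right_reaches_def right_bridge_def
  by (metis less_add_one)

lemma right_reaches_code: "right_reaches X \<pi> x x' \<Longrightarrow> \<pi> x = \<pi> x'"
  unfolding right_reaches_def right_bridge_def by metis

lemma right_reaches_if_infinitely_often_agree:
  assumes "x \<in> X" "x' \<in> X" "\<pi> x = \<pi> x'"
    and agree: "\<And>m. \<exists>i>m. \<forall>j\<in>{i..<i + int K}. x j = x' j"
  shows "right_reaches X \<pi> x x'"
  unfolding right_reaches_def
proof
  fix m
  obtain i where i: "i > m" "\<forall>j\<in>{i..<i + int K}. x j = x' j" using agree by blast
  have "right_bridge X \<pi> m x x' (join_at i x x')"
    unfolding right_bridge_def
  proof (intro conjI exI[of _ i] allI impI)
    show "join_at i x x' \<in> X" using join_mem assms i by blast
    show "\<pi> (join_at i x x') = \<pi> x" using code_join[OF assms(1,2) i(2)] assms(3) by simp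
    then show "\<pi> (join_at i x x') = \<pi> x'" using assms(3) by simp
  qed (use i in auto)
  then show "\<exists>z. right_bridge X \<pi> m x x' z" by blast
qed

lemma right_equivalent_if_infinitely_often_agree:
  assumes "x \<in> X" "x' \<in> X" "\<pi> x = \<pi> x'"
    and agree: "\<And>m. \<exists>i>m. \<forall>j\<in>{i..<i + int K}. x j = x' j"
  shows "right_equivalent X \<pi> x x'"
  unfolding right_equivalent_def
proof
  show "right_reaches X \<pi> x x'" by (rule right_reaches_if_infinitely_often_agree[OF assms])
  have "\<And>m. \<exists>i>m. \<forall>j\<in>{i..<i + int K}. x' j = x j" using agree by metis
  then show "right_reaches X \<pi> x' x"
    by (intro right_reaches_if_infinitely_often_agree) (simp_all add: assms)
qed

lemma right_equivalent_if_eventually_equal: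
  assumes "x \<in> X" "x' \<in> X" "\<pi> x = \<pi> x'" and "\<forall>j\<ge>n. x j = x' j"
  shows "right_equivalent X \<pi> x x'"
proof (rule right_equivalent_if_infinitely_often_agree[OF assms(1-3)])
  show "\<exists>i>m. \<forall>j\<in>{i..<i + int K}. x j = x' j" for m
    using assms(4) by (intro exI[of _ "max n (m + 1)"]) auto
qed

lemma right_reaches_trans:
  assumes "right_reaches X \<pi> x x'" "right_reaches X \<pi> x' x''"
  shows "right_reaches X \<pi> x x''"
  unfolding right_reaches_def
proof
  fix m
  obtain z n where z: "z \<in> X" "\<pi> z = \<pi> x" "m < n" "\<forall>i\<le>m. z i = x i" "\<forall>i\<ge>n. z i = x' i"
    using assms(1) unfolding right_reaches_def right_bridge_def by metis
  obtain z' n' where z': "z' \<in> X" "\<pi> z' = \<pi> x''" "n + int K < n'"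
      "\<forall>i\<le>n + int K. z' i = x' i" "\<forall>i\<ge>n'. z' i = x'' i"
    using assms(2) unfolding right_reaches_def right_bridge_def by metis
  have ag: "\<forall>j\<in>{n..<n + int K}. z j = z' j" using z z' by auto
  have co: "\<pi> x = \<pi> x''" using assms right_reaches_code by metis
  have "right_bridge X \<pi> m x x'' (join_at n z z')"
    unfolding right_bridge_def
  proof (intro conjI exI[of _ n'] allI impI)
    show "join_at n z z' \<in> X" by (rule join_mem[OF z(1) z'(1) ag])
    show "\<pi> (join_at n z z') = \<pi> x" "\<pi> (join_at n z z') = \<pi> x''"
      using code_join[OF z(1) z'(1) ag] z(2) z'(2) co by simp_all
  qed (use z z' in auto)
  then show "\<exists>z. right_bridge X \<pi> m x x'' z" by blast
qed

lemma right_equivalent_sym: "right_equivalent X \<pi> x x' \<Longrightarrow> right_equivalent X \<pi> x' x"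
  by (simp add: right_equivalent_def)

lemma right_equivalent_trans:
  "\<lbrakk>right_equivalent X \<pi> x x'; right_equivalent X \<pi> x' x''\<rbrakk> \<Longrightarrow> right_equivalent X \<pi> x x''"
  unfolding right_equivalent_def using right_reaches_trans by blast

definition separated :: "(int \<Rightarrow> 'a) set \<Rightarrow> bool" where
  "separated S \<longleftrightarrow> (\<forall>p\<in>S. \<forall>q\<in>S. right_equivalent X \<pi> p q \<longrightarrow> p = q)"

definition fibre :: "(int \<Rightarrow> 'b) \<Rightarrow> (int \<Rightarrow> 'a) set" where
  "fibre y = {x \<in> X. \<pi> x = y}"

text \<open>A transversal of a fibre picks exactly one point from every right equivalence class, so its
cardinality is the number of right classes of the fibre.\<close>

definition transversal :: "(int \<Rightarrow> 'b) \<Rightarrow> (int \<Rightarrow> 'a) set \<Rightarrow> bool" where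
  "transversal y S \<longleftrightarrow> finite S \<and> S \<subseteq> fibre y \<and> separated S \<and>
     (\<forall>z\<in>fibre y. \<exists>p\<in>S. right_equivalent X \<pi> z p)"

text \<open>With more than \<open>card A ^ K\<close> points, two of them carry the same \<open>K\<close>-block at each position. As there
are finitely many pairs, one pair does so at infinitely many positions to the right, which makes it
right equivalent.\<close>

lemma card_separated_le:
  assumes fin: "finite S" and S: "S \<subseteq> fibre y" and sep: "separated S"
  shows "card S \<le> card A ^ K"
proof (rule ccontr)
  assume "\<not> ?thesis"
  then have big: "card S > card A ^ K" by simp
  have finA: "finite A" using shift_space by (simp add: shift_space_def)
  let ?W = "{xs. set xs \<subseteq> A \<and> length xs = K}"
  have "\<exists>p q. p \<in> S \<and> q \<in> S \<and> p \<noteq> q \<and> subword p (int n) K = subword q (int n) K" for n :: nat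
  proof -
    have "(\<lambda>p. subword p (int n) K) ` S \<subseteq> ?W"
    proof (intro image_subsetI CollectI conjI subsetI)
      fix p a assume "p \<in> S" "a \<in> set (subword p (int n) K)"
      then show "a \<in> A"
        using S shift_space_in_alphabet[OF shift_space, of p] by (auto simp: subword_def fibre_def)
    qed simp
    then have "card ((\<lambda>p. subword p (int n) K) ` S) \<le> card A ^ K"
      using card_mono[OF finite_lists_length_eq[OF finA]] card_lists_length_eq[OF finA] by metis
    then have "\<not> inj_on (\<lambda>p. subword p (int n) K) S"
      using big by (metis card_image not_less)
    then show ?thesis unfolding inj_on_def by blast
  qed
  then obtain f g where fg: "\<And>n. f n \<in> S" "\<And>n. g n \<in> S" "\<And>n. f n \<noteq> g n"
      "\<And>n::nat. subword (f n) (int n) K = subword (g n) (int n) K" by metis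
  have "range (\<lambda>n. (f n, g n)) \<subseteq> S \<times> S" using fg(1,2) by blast
  then have "finite (range (\<lambda>n. (f n, g n)))" using fin finite_subset by blast
  then obtain a where "infinite {n \<in> UNIV. (f n, g n) = (f a, g a)}"
    using pigeonhole_infinite[OF infinite_UNIV_nat, of "\<lambda>n. (f n, g n)"] by blast
  then have inf: "infinite {n. (f n, g n) = (f a, g a)}" by (simp only: UNIV_I simp_thms)
  have "right_equivalent X \<pi> (f a) (g a)"
  proof (rule right_equivalent_if_infinitely_often_agree)
    show "f a \<in> X" "g a \<in> X" "\<pi> (f a) = \<pi> (g a)" using fg(1,2)[of a] S by (auto simp: fibre_def)
    fix m
    obtain n where n: "n > nat m" "(f n, g n) = (f a, g a)"
      using inf unfolding infinite_nat_iff_unbounded by blast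
    have "\<forall>j\<in>{0..<int K}. f a (int n + j) = g a (int n + j)"
      using fg(4)[of n] n(2) by (simp only: subword_eq_iff prod.inject) 
    then have "\<forall>j\<in>{int n..<int n + int K}. f a j = g a j"
      by (metis (no_types, lifting) add_diff_cancel_left' add.commute atLeastLessThan_iff diff_add_cancel diff_ge_0_iff_ge diff_less_eq)
    then show "\<exists>i>m. \<forall>j\<in>{i..<i + int K}. f a j = g a j"
      using n(1) by (intro exI[of _ "int n"]) auto
  qed
  then show False using sep fg unfolding separated_def by blast
qed

text \<open>A separated set of maximal cardinality meets every class.\<close>

lemma transversal_exists: "\<exists>S. transversal y S"
proof -
  let ?P = "\<lambda>S. finite S \<and> S \<subseteq> fibre y \<and> separated S"
  have "?P {}" by (simp add: separated_def)
  moreover have "\<forall>S. ?P S \<longrightarrow> card S < Suc (card A ^ K)"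
    using card_separated_le[of _ y] by (simp add: less_Suc_eq_le)
  ultimately obtain S where S: "?P S" and mx: "\<And>T. ?P T \<Longrightarrow> card T \<le> card S"
    using ex_has_greatest_nat[of ?P "{}" card] by metis
  have "\<exists>p\<in>S. right_equivalent X \<pi> z p" if z: "z \<in> fibre y" for z
  proof (rule ccontr)
    assume no: "\<not> ?thesis"
    have "right_equivalent X \<pi> z z"
      using z right_reaches_refl by (simp add: fibre_def right_equivalent_def)
    then have "z \<notin> S" using no by blast
    have "?P (insert z S)"
      using S z no right_equivalent_sym unfolding separated_def by blast
    then have "card (insert z S) \<le> card S" by (rule mx)
    then show False using \<open>z \<notin> S\<close> S by simp
  qed
  then show ?thesis using S unfolding transversal_def by blast
qed

text \<open>Each point of the fibre is bridged to a member of \<open>S\<close> within some finite time. The time can be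
chosen uniformly because the fibre is compact, and a bridge that leaves \<open>z\<close> also leaves, after
changing its left tail, every point close to \<open>z\<close>.\<close>

lemma routing_forward:
  assumes S: "transversal y S"
  shows "\<exists>n::nat. \<forall>z\<in>fibre y. \<exists>p\<in>S. \<exists>z'\<in>fibre y.
           (\<forall>j\<le>0. z' j = z j) \<and> (\<forall>j\<ge>int n. z' j = p j)"
proof (rule ccontr)
  assume "\<not> ?thesis"
  then obtain s where s: "\<And>n. s n \<in> fibre y" and bad: "\<And>n p z'. \<lbrakk>p \<in> S; z' \<in> fibre y;
      \<forall>j\<le>0. z' j = s n j; \<forall>j\<ge>int n. z' j = p j\<rbrakk> \<Longrightarrow> False"
    by metis
  have sX: "s n \<in> X" "\<pi> (s n) = y" for n using s by (auto simp: fibre_def)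
  obtain z where z: "z \<in> X" and lim: "\<And>N. \<exists>n\<ge>N. \<forall>j\<in>{- int N..int N}. s n j = z j \<and> \<pi> (s n) j = \<pi> z j"
    using cluster_point[of s] sX by blast
  have "\<pi> z j = y j" for j
  proof -
    have "j \<in> {- int (nat \<bar>j\<bar>)..int (nat \<bar>j\<bar>)}" by auto
    then show ?thesis using lim[of "nat \<bar>j\<bar>"] sX by metis
  qed
  then have zy: "\<pi> z = y" by blast
  then obtain p where p: "p \<in> S" "right_reaches X \<pi> z p"
    using S z unfolding transversal_def fibre_def right_equivalent_def by blast
  obtain z' q where z': "z' \<in> X" "\<pi> z' = y" "0 < q" "\<forall>j\<le>0. z' j = z j" "\<forall>j\<ge>q. z' j = p j"
    using p(2) zy unfolding right_reaches_def right_bridge_def by metis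
  obtain n where n: "n \<ge> nat q + K" "\<forall>j\<in>{- int (nat q + K)..int (nat q + K)}. s n j = z j"
    using lim by blast
  \<comment> \<open>The block at this position ends at the coordinate \<open>0\<close>, up to which \<open>z'\<close> follows \<open>z\<close>.\<close>
  let ?i = "1 - int K"
  have ag: "\<forall>j\<in>{?i..<?i + int K}. s n j = z' j" using n(2) z'(4) by auto
  have "join_at ?i (s n) z' \<in> fibre y"
    using join_mem[OF sX(1) z'(1) ag] code_join[OF sX(1) z'(1) ag] sX z' by (simp add: fibre_def)
  moreover have "\<forall>j\<le>0. join_at ?i (s n) z' j = s n j"
    using ag by (auto simp: join_at_def)
  moreover have "\<forall>j\<ge>int n. join_at ?i (s n) z' j = p j"
    using n(1) z'(3,5) by auto
  ultimately show False using bad p(1) by blast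
qed

end

section \<open>Transition blocks\<close>

locale class_closing_code = sft_code +
  assumes class_closing: "right_class_closing X \<pi>"
begin

lemma right_equivalent_if_left_asymptotic:
  assumes "x \<in> X" "x' \<in> X" "\<pi> x = \<pi> x'" "\<forall>j\<le>m. x j = x' j"
  shows "right_equivalent X \<pi> x x'"
  using class_closing assms unfolding right_class_closing_def left_asymptotic_def by blast

text \<open>Routing through a symbol at the time \<open>n0\<close>, as in the theory of class degrees, with a block of length
\<open>K\<close> in place of the symbol because joining needs that much overlap.\<close>

definition routes_through :: "nat \<Rightarrow> nat \<Rightarrow> (int \<Rightarrow> 'a) \<Rightarrow> (int \<Rightarrow> 'a) \<Rightarrow> bool" where
  "routes_through n0 n1 z p \<longleftrightarrow> (\<exists>z'\<in>X. \<pi> z' = \<pi> z \<and> (\<forall>j\<le>0. z' j = z j) \<and>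
     (\<forall>j\<in>{int n0..<int n0 + int K}. z' j = p j) \<and> (\<forall>j\<ge>int n1. z' j = z j))"

text \<open>The central block of \<open>y\<close> is a transition block: a point whose image shows it can be routed through
a member of \<open>S\<close>. A point \<open>z\<close> of the fibre itself goes forward to some \<open>p\<close> in \<open>S\<close>; the
intermediate point is left asymptotic to \<open>z\<close>, so class-closing yields a bridge from \<open>p\<close> back to
\<open>z\<close>. By compactness this passes to the points whose image agrees with \<open>y\<close> on a long enough
window only.\<close>

lemma routing_block:
  assumes S: "transversal y S"
  shows "\<exists>n0 n1::nat. n0 + K \<le> n1 \<and> (\<forall>z\<in>X. (\<forall>j\<in>{- int n1..int n1}. \<pi> z j = y j) \<longrightarrow>
           (\<exists>p\<in>S. routes_through n0 n1 z p))"
proof -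
  obtain n0 :: nat where n0: "\<And>z. z \<in> fibre y \<Longrightarrow> \<exists>p\<in>S. \<exists>z'\<in>fibre y.
      (\<forall>j\<le>0. z' j = z j) \<and> (\<forall>j\<ge>int n0. z' j = p j)"
    using routing_forward[OF S] by blast
  have "\<exists>n1\<ge>n0 + K. \<forall>z\<in>X. (\<forall>j\<in>{- int n1..int n1}. \<pi> z j = y j) \<longrightarrow>
           (\<exists>p\<in>S. routes_through n0 n1 z p)"
  proof (rule ccontr)
    assume no: "\<not> ?thesis"
    then have "\<forall>n1\<ge>n0 + K. \<exists>z. z \<in> X \<and> (\<forall>j\<in>{- int n1..int n1}. \<pi> z j = y j) \<and>
        \<not> (\<exists>p\<in>S. routes_through n0 n1 z p)"
      by blast
    moreover have "n0 + K \<le> n + n0 + K" for n by simp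
    ultimately have "\<forall>n. \<exists>z. z \<in> X \<and> (\<forall>j\<in>{- int (n + n0 + K)..int (n + n0 + K)}. \<pi> z j = y j) \<and>
        \<not> (\<exists>p\<in>S. routes_through n0 (n + n0 + K) z p)"
      by blast
    then obtain s where s: "\<And>n. s n \<in> X"
        "\<And>n. \<forall>j\<in>{- int (n + n0 + K)..int (n + n0 + K)}. \<pi> (s n) j = y j"
        "\<And>n. \<not> (\<exists>p\<in>S. routes_through n0 (n + n0 + K) (s n) p)"
      by metis
    have sX: "s n \<in> X" and sy: "\<And>j. j \<in> {- int n..int n} \<Longrightarrow> \<pi> (s n) j = y j" for n
      using s(1,2)[of n] by auto
    have bad: False if "p \<in> S" "z' \<in> X" "\<pi> z' = \<pi> (s n)" "\<forall>j\<le>0. z' j = s n j"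
        "\<forall>j\<in>{int n0..<int n0 + int K}. z' j = p j" "\<forall>j\<ge>int n. z' j = s n j" for p z' n
    proof -
      have "routes_through n0 (n + n0 + K) (s n) p"
        unfolding routes_through_def using that by (intro bexI[of _ z']) auto
      then show False using s(3) that(1) by blast
    qed
    obtain z where z: "z \<in> X"
      and lim: "\<And>N. \<exists>n\<ge>N. \<forall>j\<in>{- int N..int N}. s n j = z j \<and> \<pi> (s n) j = \<pi> z j"
      using cluster_point[of s] sX by blast
    have "\<pi> z j = y j" for j
    proof -
      let ?N = "nat \<bar>j\<bar>"
      have j: "j \<in> {- int ?N..int ?N}" by auto
      obtain n where n: "n \<ge> ?N" "\<forall>i\<in>{- int ?N..int ?N}. s n i = z i \<and> \<pi> (s n) i = \<pi> z i"
        using lim by blast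
      have "\<pi> (s n) j = y j" using n(1) by (intro sy) auto
      then show ?thesis using n(2) j by metis
    qed
    then have zy: "\<pi> z = y" by blast
    then obtain p z1 where p: "p \<in> S" and z1: "z1 \<in> X" "\<pi> z1 = y" "\<forall>j\<le>0. z1 j = z j"
        "\<forall>j\<ge>int n0. z1 j = p j"
      using n0[of z] z unfolding fibre_def by blast
    have pX: "p \<in> X" "\<pi> p = y" using S p unfolding transversal_def fibre_def by auto
    have "right_equivalent X \<pi> z1 p"
      using right_equivalent_if_eventually_equal[OF z1(1) pX(1) _ z1(4)] z1(2) pX(2) by simp
    moreover have "right_equivalent X \<pi> z1 z"
      using right_equivalent_if_left_asymptotic[OF z1(1) z _ z1(3)] z1(2) zy by simp
    ultimately have "right_reaches X \<pi> p z"
      using right_equivalent_sym right_equivalent_trans unfolding right_equivalent_def by blast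
    then obtain z2 q where z2: "z2 \<in> X" "\<pi> z2 = y" "int n0 + int K < q"
        "\<forall>j\<le>int n0 + int K. z2 j = p j" "\<forall>j\<ge>q. z2 j = z j"
      using zy unfolding right_reaches_def right_bridge_def by metis
    have ag3: "\<forall>j\<in>{int n0..<int n0 + int K}. z1 j = z2 j" using z1 z2 by auto
    \<comment> \<open>The point \<open>z3\<close> is the round trip from \<open>z\<close> through the block of \<open>p\<close> back to \<open>z\<close>.\<close>
    define z3 where "z3 = join_at (int n0) z1 z2"
    have z3: "z3 \<in> X" "\<pi> z3 = y"
      using join_mem[OF z1(1) z2(1) ag3] code_join[OF z1(1) z2(1) ag3] z1(2) z2(2)
      by (simp_all add: z3_def)
    have z3l: "\<forall>j\<le>0. z3 j = z j" and z3m: "\<forall>j\<in>{int n0..<int n0 + int K}. z3 j = p j"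
      and z3r: "\<forall>j\<ge>q. z3 j = z j"
      using z1 z2 by (auto simp: z3_def join_at_def)
    let ?N = "nat q + K"
    obtain n where n: "n \<ge> ?N" "\<forall>j\<in>{- int ?N..int ?N}. s n j = z j"
      using lim by blast
    let ?i = "1 - int K"
    have ag: "\<forall>j\<in>{?i..<?i + int K}. s n j = z3 j" using n(2) z3l by auto
    \<comment> \<open>The round trip is transplanted into \<open>s n\<close>, first at its departure and then at its return.\<close>
    define w where "w = join_at ?i (s n) z3"
    have w: "w \<in> X" "\<pi> w = join_at (?i + int r) (\<pi> (s n)) y"
      using join_mem[OF sX z3(1) ag] code_join[OF sX z3(1) ag] z3(2) by (simp_all add: w_def)
    have wl: "\<forall>j\<le>0. w j = s n j" and wr: "\<forall>j>- int K. w j = z3 j"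
      using ag by (auto simp: w_def join_at_def)
    have ag': "\<forall>j\<in>{q..<q + int K}. w j = s n j"
      using wr z3r n(2) z2(3) by auto
    define w' where "w' = join_at q w (s n)"
    have "w' \<in> X" using join_mem[OF w(1) sX ag'] by (simp add: w'_def)
    moreover have "\<pi> w' = \<pi> (s n)"
    proof
      fix j
      have "\<pi> w' j = join_at (q + int r) (\<pi> w) (\<pi> (s n)) j"
        using code_join[OF w(1) sX ag'] by (simp add: w'_def)
      moreover have "y j = \<pi> (s n) j" if "?i + int r \<le> j" "j < q + int r"
        using that n(1) radius_window z2(3) by (intro sy[symmetric]) auto
      ultimately show "\<pi> w' j = \<pi> (s n) j"
        by (auto simp: w(2) join_at_def)
    qed
    moreover have "\<forall>j\<le>0. w' j = s n j" "\<forall>j\<in>{int n0..<int n0 + int K}. w' j = p j"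
        "\<forall>j\<ge>int n. w' j = s n j"
      using wl wr z3m z2(3) n(1) by (auto simp: w'_def join_at_def)
    ultimately show False using bad p by blast
  qed
  then show ?thesis by blast
qed

section \<open>Lifting through a transition block\<close>

text \<open>The heart of the argument. As \<open>y\<close> shows the transition block, each member \<open>z\<close> of a transversal
\<open>T\<close> of its fibre is routed through some \<open>f z\<close> in \<open>S\<close>. If \<open>f z1 = f z2\<close>, then following
\<open>z1\<close> up to this common block and \<open>z2\<close> afterwards gives a point left asymptotic to \<open>z1\<close> and
eventually equal to \<open>z2\<close>, so \<open>z1\<close> and \<open>z2\<close> are right equivalent. Thus \<open>f\<close> is injective, and
minimality of \<open>S\<close> makes it surjective: every member of \<open>S\<close> that \<open>x\<close> may be routed through
is also visited on the way to some point over \<open>y\<close>, and \<open>x\<close> can change over to that point.\<close>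

lemma lift_through_block:
  assumes S: "transversal y0 S" and minimal: "\<And>T. transversal y T \<Longrightarrow> card S \<le> card T"
    and route: "\<And>z. \<lbrakk>z \<in> X; \<forall>j\<in>{- int n1..int n1}. \<pi> z j = y0 j\<rbrakk> \<Longrightarrow> \<exists>p\<in>S. routes_through n0 n1 z p"
    and n: "n0 + K \<le> n1"
    and x: "x \<in> X" and xy0: "\<forall>j\<in>{- int n1..int n1}. \<pi> x j = y0 j"
    and yx: "\<forall>j\<le>int n1. y j = \<pi> x j"
  shows "\<exists>x'\<in>X. \<pi> x' = y \<and> (\<forall>j<0. x' j = x j)"
proof -
  obtain T where T: "transversal y T" using transversal_exists by blast
  have TX: "z \<in> X" "\<pi> z = y" if "z \<in> T" for z
    using T that unfolding transversal_def fibre_def by auto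
  have "\<exists>p\<in>S. routes_through n0 n1 z p" if "z \<in> T" for z
    using TX[OF that] xy0 yx by (intro route) auto
  then obtain f where f: "\<And>z. z \<in> T \<Longrightarrow> f z \<in> S" "\<And>z. z \<in> T \<Longrightarrow> routes_through n0 n1 z (f z)"
    by metis
  have r_n1: "int n0 + int r \<le> int n1 + 1" using n radius_window by linarith
  have inj: "inj_on f T"
  proof (rule inj_onI)
    fix z1 z2 assume z: "z1 \<in> T" "z2 \<in> T" "f z1 = f z2"
    obtain z1' where z1': "z1' \<in> X" "\<pi> z1' = y" "\<forall>j\<le>0. z1' j = z1 j"
        "\<forall>j\<in>{int n0..<int n0 + int K}. z1' j = f z1 j"
      using f(2)[OF z(1)] TX[OF z(1)] unfolding routes_through_def by auto
    obtain z2' where z2': "z2' \<in> X" "\<pi> z2' = y" "\<forall>j\<ge>int n1. z2' j = z2 j"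
        "\<forall>j\<in>{int n0..<int n0 + int K}. z2' j = f z2 j"
      using f(2)[OF z(2)] TX[OF z(2)] unfolding routes_through_def by auto
    have ag: "\<forall>j\<in>{int n0..<int n0 + int K}. z1' j = z2' j" using z1' z2' z(3) by simp
    define w where "w = join_at (int n0) z1' z2'"
    have w: "w \<in> X" "\<pi> w = y"
      using join_mem[OF z1'(1) z2'(1) ag] code_join[OF z1'(1) z2'(1) ag] z1'(2) z2'(2)
      by (simp_all add: w_def)
    \<comment> \<open>The point \<open>w\<close> links \<open>z1\<close>, whose left tail it has, with \<open>z2\<close>, whose right tail it has.\<close>
    have "right_equivalent X \<pi> z1 w"
    proof (rule right_equivalent_if_left_asymptotic)
      show "\<forall>j\<le>-1. z1 j = w j" using z1'(3) by (simp add: w_def)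
    qed (use w TX z in auto)
    moreover have "right_equivalent X \<pi> w z2"
    proof (rule right_equivalent_if_eventually_equal)
      show "\<forall>j\<ge>int n1. w j = z2 j" using z2'(3) n by (simp add: w_def)
    qed (use w TX z in auto)
    ultimately show "z1 = z2"
      using T z right_equivalent_trans unfolding transversal_def separated_def by blast
  qed
  have "finite S" using S unfolding transversal_def by blast
  have "f ` T = S"
  proof (rule card_subset_eq[OF \<open>finite S\<close>])
    show "f ` T \<subseteq> S" using f(1) by blast
    then have "card (f ` T) \<le> card S" by (rule card_mono[OF \<open>finite S\<close>])
    then show "card (f ` T) = card S" using minimal[OF T] card_image[OF inj] by linarith
  qed
  moreover obtain p where p: "p \<in> S" "routes_through n0 n1 x p" using route[OF x xy0] by blast
  ultimately obtain z where z: "z \<in> T" "f z = p" by blast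
  obtain x1 where x1: "x1 \<in> X" "\<pi> x1 = \<pi> x" "\<forall>j\<le>0. x1 j = x j"
      "\<forall>j\<in>{int n0..<int n0 + int K}. x1 j = p j" 
    using p(2) unfolding routes_through_def by auto
  obtain z1 where z1: "z1 \<in> X" "\<pi> z1 = y" "\<forall>j\<in>{int n0..<int n0 + int K}. z1 j = p j"
    using f(2)[OF z(1)] z(2) TX[OF z(1)] unfolding routes_through_def by auto
  have ag: "\<forall>j\<in>{int n0..<int n0 + int K}. x1 j = z1 j" using x1 z1 by simp
  define x' where "x' = join_at (int n0) x1 z1"
  have "x' \<in> X" using join_mem[OF x1(1) z1(1) ag] by (simp add: x'_def)
  moreover have "\<pi> x' = y"
  proof
    fix j
    have "\<pi> x' j = join_at (int n0 + int r) (\<pi> x) y j"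
      using code_join[OF x1(1) z1(1) ag] x1(2) z1(2) by (simp add: x'_def)
    moreover have "\<pi> x j = y j" if "j < int n0 + int r" using yx r_n1 that by simp
    ultimately show "\<pi> x' j = y j" by (auto simp: join_at_def)
  qed
  moreover have "\<forall>j<0. x' j = x j" using x1(3) by (simp add: x'_def)
  ultimately show ?thesis by blast
qed

section \<open>Bridges with uniform delay\<close>

text \<open>Compactness again: otherwise there are pairs of points that agree up to \<open>0\<close>, have images that agree
ever further to the right, but such that no point over the image of the second follows the first up
to \<open>1\<close>. They accumulate at a left asymptotic pair with equal images, for which class-closing gives
a bridge; this bridge can be transplanted to the nearby pairs.\<close>

lemma bridge_step:
  "\<exists>n::nat. \<forall>x\<in>X. \<forall>x'\<in>X. (\<forall>j\<le>0. x j = x' j) \<longrightarrow> (\<forall>j\<le>int n. \<pi> x j = \<pi> x' j) \<longrightarrow>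
     (\<exists>z\<in>X. (\<forall>j\<le>1. z j = x j) \<and> \<pi> z = \<pi> x')"
proof (rule ccontr)
  assume "\<not> ?thesis"
  then have "\<forall>n::nat. \<exists>x x'. x \<in> X \<and> x' \<in> X \<and> (\<forall>j\<le>0. x j = x' j) \<and> (\<forall>j\<le>int n. \<pi> x j = \<pi> x' j) \<and>
     \<not> (\<exists>z\<in>X. (\<forall>j\<le>1. z j = x j) \<and> \<pi> z = \<pi> x')"
    by blast
  then obtain s s' where s: "\<And>n::nat. s n \<in> X" and s': "\<And>n. s' n \<in> X"
    and eq: "\<And>n. \<forall>j\<le>0. s n j = s' n j" and code_eq: "\<And>n. \<forall>j\<le>int n. \<pi> (s n) j = \<pi> (s' n) j"
    and bad: "\<And>n z. z \<in> X \<Longrightarrow> \<forall>j\<le>1. z j = s n j \<Longrightarrow> \<pi> z = \<pi> (s' n) \<Longrightarrow> False"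
    by metis
  obtain x x' where x: "x \<in> X" and x': "x' \<in> X" and lim: "\<And>N. \<exists>n\<ge>N. \<forall>j\<in>{- int N..int N}.
       s n j = x j \<and> \<pi> (s n) j = \<pi> x j \<and> s' n j = x' j \<and> \<pi> (s' n) j = \<pi> x' j"
    using cluster_pair[of s s', OF s s'] by blast
  have "x j = x' j" if "j \<le> 0" for j
  proof -
    have "j \<in> {- int (nat \<bar>j\<bar>)..int (nat \<bar>j\<bar>)}" by auto
    then show ?thesis using lim[of "nat \<bar>j\<bar>"] eq that by metis
  qed
  moreover have "\<pi> x = \<pi> x'"
  proof
    fix j
    have j: "j \<in> {- int (nat \<bar>j\<bar>)..int (nat \<bar>j\<bar>)}" by auto
    obtain n where n: "n \<ge> nat \<bar>j\<bar>" "\<pi> (s n) j = \<pi> x j" "\<pi> (s' n) j = \<pi> x' j"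
      using lim[of "nat \<bar>j\<bar>"] j by blast
    have "j \<le> int n" using n(1) by linarith
    then show "\<pi> x j = \<pi> x' j" using n code_eq by metis
  qed
  ultimately have "right_reaches X \<pi> x x'"
    using right_equivalent_if_left_asymptotic[OF x x'] unfolding right_equivalent_def by blast
  then obtain z q where z: "z \<in> X" "\<pi> z = \<pi> x'" "1 < q" "\<forall>j\<le>1. z j = x j" "\<forall>j\<ge>q. z j = x' j"
    unfolding right_reaches_def right_bridge_def by metis
  let ?N = "nat q + K"
  obtain n where n: "n \<ge> ?N" and near: "\<forall>j\<in>{- int ?N..int ?N}.
       s n j = x j \<and> \<pi> (s n) j = \<pi> x j \<and> s' n j = x' j \<and> \<pi> (s' n) j = \<pi> x' j"
    using lim by blast
  \<comment> \<open>The block at this position ends at the coordinate \<open>1\<close>, up to which \<open>z\<close> follows \<open>x\<close>.\<close>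
  let ?i = "2 - int K"
  have ag: "\<forall>j\<in>{?i..<?i + int K}. s n j = z j" using near z(3,4) by auto
  define w where "w = join_at ?i (s n) z"
  have w: "w \<in> X" "\<pi> w = join_at (?i + int r) (\<pi> (s n)) (\<pi> x')"
    using join_mem[OF s z(1) ag] code_join[OF s z(1) ag] z(2) by (simp_all add: w_def)
  have wl: "\<forall>j\<le>1. w j = s n j" and wr: "\<forall>j\<ge>2. w j = z j"
    using ag by (auto simp: w_def join_at_def)
  have ag': "\<forall>j\<in>{q..<q + int K}. w j = s' n j"
    using wr z(3,5) near by auto
  define w' where "w' = join_at q w (s' n)"
  have "w' \<in> X" using join_mem[OF w(1) s' ag'] by (simp add: w'_def)
  moreover have "\<forall>j\<le>1. w' j = s n j" using wl z(3) by (simp add: w'_def)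
  moreover have "\<pi> w' = \<pi> (s' n)"
  proof
    fix j
    have "\<pi> w' j = join_at (q + int r) (\<pi> w) (\<pi> (s' n)) j"
      using code_join[OF w(1) s' ag'] by (simp add: w'_def)
    moreover have "\<pi> (s n) j = \<pi> (s' n) j" if "j < ?i + int r"
    proof -
      have "j \<le> int n" using that n z(3) radius_window by linarith
      then show ?thesis using code_eq by blast
    qed
    moreover have "\<pi> x' j = \<pi> (s' n) j" if "?i + int r \<le> j" "j < q + int r"
    proof -
      have "j \<in> {- int ?N..int ?N}" using that z(3) radius_window by auto
      then show ?thesis using near by simp
    qed
    ultimately show "\<pi> w' j = \<pi> (s' n) j"
      by (auto simp: w(2) join_at_def)
  qed
  ultimately show False using bad by blast
qed

text \<open>Two points that separated long ago, over images that agree up to \<open>0\<close>, can be made to separate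
late, within a delay \<open>D\<close> that depends on neither.
The departure from \<open>x\<close> is postponed one coordinate at a time: the point obtained so far
is left asymptotic to \<open>x\<close> up to its own departure, so the previous lemma applies to \<open>x\<close> and
that point. The constant does not grow since every step compares with \<open>x\<close> afresh.\<close>

lemma uniform_bridge:
  "\<exists>D::nat. \<forall>x\<in>X. \<forall>x'\<in>X. left_asymptotic x x' \<longrightarrow> (\<forall>j\<le>0. \<pi> x j = \<pi> x' j) \<longrightarrow>
     (\<exists>z\<in>X. (\<forall>j\<le>- int D. z j = x j) \<and> \<pi> z = \<pi> x')"
proof -
  obtain n :: nat where n: "\<And>x x'. \<lbrakk>x \<in> X; x' \<in> X; \<forall>j\<le>0. x j = x' j; \<forall>j\<le>int n. \<pi> x j = \<pi> x' j\<rbrakk> \<Longrightarrow>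
     \<exists>z\<in>X. (\<forall>j\<le>1. z j = x j) \<and> \<pi> z = \<pi> x'"
    using bridge_step by blast
  have step_right: "\<exists>z\<in>X. (\<forall>j\<le>m + 1. z j = x j) \<and> \<pi> z = \<pi> x'"
    if x: "x \<in> X" "x' \<in> X" and eq: "\<forall>j\<le>m. x j = x' j" and ceq: "\<forall>j\<le>m + int n. \<pi> x j = \<pi> x' j" for x x' m
  proof -
    have "\<exists>z\<in>X. (\<forall>j\<le>1. z j = translate m x j) \<and> \<pi> z = \<pi> (translate m x')"
    proof (rule n)
      show "translate m x \<in> X" "translate m x' \<in> X" using x by (blast intro: translate_mem)+
      show "\<forall>j\<le>0. translate m x j = translate m x' j" using eq by simp
      show "\<forall>j\<le>int n. \<pi> (translate m x) j = \<pi> (translate m x') j"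
        unfolding code_translate[OF x(1)] code_translate[OF x(2)] using ceq by simp
    qed
    then obtain z where z: "z \<in> X" "\<forall>j\<le>1. z j = translate m x j" "\<pi> z = \<pi> (translate m x')" by blast
    show ?thesis
    proof (intro bexI[of _ "translate (- m) z"] conjI allI impI)
      show "translate (- m) z \<in> X" by (rule translate_mem[OF z(1)])
      show "\<pi> (translate (- m) z) = \<pi> x'"
        unfolding code_translate[OF z(1)] z(3) code_translate[OF x(2)] by simp
      show "translate (- m) z j = x j" if "j \<le> m + 1" for j
        using z(2) that by simp
    qed
  qed
  have "\<exists>z\<in>X. (\<forall>j\<le>- int n. z j = x j) \<and> \<pi> z = \<pi> x'"
    if x: "x \<in> X" "x' \<in> X" and la: "left_asymptotic x x'" and ceq: "\<forall>j\<le>0. \<pi> x j = \<pi> x' j" for x x'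
  proof -
    obtain a where a: "\<forall>j\<le>a. x j = x' j" using la unfolding left_asymptotic_def by blast
    \<comment> \<open>If the points agree beyond \<open>- n\<close>, the starting point must be lowered to \<open>- n\<close>; the induction is then void.\<close>
    define b where "b = min a (- int n)"
    have "b \<le> m \<Longrightarrow> m \<le> - int n \<longrightarrow> (\<exists>z\<in>X. (\<forall>j\<le>m. z j = x j) \<and> \<pi> z = \<pi> x')" for m
    proof (induction rule: int_ge_induct)
      case base
      show ?case using a x(2) by (auto simp: b_def intro!: bexI[of _ x'])
    next
      case (step m)
      show ?case
      proof
        assume m: "m + 1 \<le> - int n"
        then obtain z where z: "z \<in> X" "\<forall>j\<le>m. z j = x j" "\<pi> z = \<pi> x'" using step by auto
        show "\<exists>z\<in>X. (\<forall>j\<le>m + 1. z j = x j) \<and> \<pi> z = \<pi> x'"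
          using step_right[of x z m] x z m ceq by auto
      qed
    qed
    then show ?thesis by (simp add: b_def)
  qed
  then show ?thesis by blast
qed

section \<open>Right continuity\<close>

text \<open>The point \<open>x\<close> need not show the transition block in its left tail. It is approximated by points
\<open>g\<close> that do, which irreducibility provides; correspondingly \<open>y\<close> is approximated by the points \<open>y'\<close>
of \<open>\<pi> ` X\<close> that follow \<open>\<pi> g\<close> on the far left. The lift over \<open>y'\<close> may separate from \<open>g\<close> arbitrarily
early, but a bridge repairs this: by the uniform delay there is also a lift that follows \<open>g\<close>
up to \<open>- D\<close>. These lifts accumulate at the desired point.\<close>

lemma right_continuing_at_0:
  assumes irr: "irreducible_shift X"
    and Y: "\<And>y t. y \<in> \<pi> ` X \<Longrightarrow> translate t y \<in> \<pi> ` X"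
    and Yjoin: "\<And>y y' i. \<lbrakk>y \<in> \<pi> ` X; y' \<in> \<pi> ` X; \<forall>j\<in>{i..<i + int k}. y j = y' j\<rbrakk> \<Longrightarrow> join_at i y y' \<in> \<pi> ` X"
    and x: "x \<in> X" and y: "y \<in> \<pi> ` X" and yx: "\<forall>j\<le>0. y j = \<pi> x j"
  shows "\<exists>x'\<in>X. \<pi> x' = y \<and> left_asymptotic x' x"
proof -
  \<comment> \<open>A fibre with the least number of right classes supplies the transition block.\<close>
  let ?P = "\<lambda>S. \<exists>y\<in>\<pi> ` X. transversal y S"
  obtain S' where "?P S'" using y transversal_exists by blast
  from ex_has_least_nat[of ?P, OF this, of card]
  obtain S where "?P S" and mn: "\<forall>T. ?P T \<longrightarrow> card S \<le> card T" by blast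
  then obtain y0 where y0: "y0 \<in> \<pi> ` X" and S: "transversal y0 S" by blast
  have minimal: "card S \<le> card T" if "y \<in> \<pi> ` X" "transversal y T" for y T
    using mn that by blast
  obtain n0 n1 where n01: "n0 + K \<le> n1" and route: "\<And>z. \<lbrakk>z \<in> X; \<forall>j\<in>{- int n1..int n1}. \<pi> z j = y0 j\<rbrakk>
      \<Longrightarrow> \<exists>p\<in>S. routes_through n0 n1 z p"
    using routing_block[OF S] by blast
  obtain p where p: "p \<in> X" "\<pi> p = y0" using y0 by blast
  obtain D :: nat where D: "\<And>x x'. \<lbrakk>x \<in> X; x' \<in> X; left_asymptotic x x'; \<forall>j\<le>0. \<pi> x j = \<pi> x' j\<rbrakk> \<Longrightarrow>
     \<exists>z\<in>X. (\<forall>j\<le>- int D. z j = x j) \<and> \<pi> z = \<pi> x'"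
    using uniform_bridge by blast
  have approx: "\<exists>z\<in>X. (\<forall>j\<in>{- int n..- int D}. z j = x j) \<and> (\<forall>j\<ge>- int n. \<pi> z j = y j)" for n
  proof -
    \<comment> \<open>Here \<open>n\<close> is the precision wanted, \<open>n1\<close> leaves room for the transition block, and \<open>k\<close> for joining images.\<close>
    define N where "N = n + n1 + k"
    obtain g t where g: "g \<in> X" and t: "t + int (N + r) < - int (N + r)"
      and gp: "\<forall>j\<in>{- int (N + r)..int (N + r)}. g (t + j) = p j"
      and gx: "\<forall>j\<in>{- int (N + r)..int (N + r)}. g j = x j"
      using irreducible_shift_connect[OF shift_space irr p(1) x, of "N + r"] by blast
    have cgx: "\<forall>j\<in>{- int N..int N}. \<pi> g j = \<pi> x j" using code_agree[OF g x gx] .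
    have "\<forall>j\<in>{- int (N + r)..int (N + r)}. translate t g j = p j"
      using gp by (simp add: add.commute)
    then have "\<forall>j\<in>{- int N..int N}. \<pi> (translate t g) j = \<pi> p j"
      by (rule code_agree[OF translate_mem[OF g] p(1)])
    then have cgp: "\<forall>j\<in>{- int n1..int n1}. \<pi> (translate t g) j = y0 j"
      using p(2) by (auto simp: N_def)
    define y' where "y' = join_at (- int N) (\<pi> g) y"
    have y'g: "\<forall>j\<le>0. y' j = \<pi> g j"
      using cgx yx by (auto simp: y'_def join_at_def)
    have y': "y' \<in> \<pi> ` X"
      unfolding y'_def using g y cgx yx by (intro Yjoin) (auto simp: N_def)
    have "\<exists>x'\<in>X. \<pi> x' = translate t y' \<and> (\<forall>j<0. x' j = translate t g j)"
    proof (rule lift_through_block[OF S _ route n01 translate_mem[OF g] cgp])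
      show "card S \<le> card T" if "transversal (translate t y') T" for T
        using minimal[OF Y[OF y'] that] .
      show "\<forall>j\<le>int n1. translate t y' j = \<pi> (translate t g) j"
        using y'g t by (auto simp: code_translate[OF g] N_def)
    qed
    then obtain x1 where x1: "x1 \<in> X" "\<pi> x1 = translate t y'" "\<forall>j<0. x1 j = translate t g j" by blast
    define x2 where "x2 = translate (- t) x1"
    have x2: "x2 \<in> X" "\<pi> x2 = y'"
      unfolding x2_def code_translate[OF x1(1)] x1(2) by (rule translate_mem[OF x1(1)]) simp
    have "\<forall>j\<le>t - 1. g j = x2 j" using x1(3) by (simp add: x2_def)
    then have "left_asymptotic g x2" unfolding left_asymptotic_def by blast
    then obtain z where z: "z \<in> X" "\<forall>j\<le>- int D. z j = g j" "\<pi> z = y'"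
      using D[OF g x2(1)] x2(2) y'g by auto
    show ?thesis
    proof (intro bexI[of _ z] conjI)
      show "\<forall>j\<in>{- int n..- int D}. z j = x j" using z(2) gx by (auto simp: N_def)
      show "\<forall>j\<ge>- int n. \<pi> z j = y j" using z(3) by (simp add: y'_def N_def)
    qed (rule z(1))
  qed
  then obtain s where s: "\<And>n. s n \<in> X" and sx: "\<And>n::nat. \<forall>j\<in>{- int n..- int D}. s n j = x j"
    and sy: "\<And>n. \<forall>j\<ge>- int n. \<pi> (s n) j = y j" by metis
  obtain x' where x': "x' \<in> X"
    and lim: "\<And>N. \<exists>n\<ge>N. \<forall>j\<in>{- int N..int N}. s n j = x' j \<and> \<pi> (s n) j = \<pi> x' j"
    using cluster_point[of s, OF s] by blast
  have "x' j = x j" if "j \<le> - int D" for j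
  proof -
    have "j \<in> {- int (nat \<bar>j\<bar>)..int (nat \<bar>j\<bar>)}" by auto
    then obtain n where n: "n \<ge> nat \<bar>j\<bar>" "s n j = x' j" using lim by blast
    then have "j \<in> {- int n..- int D}" using that by auto
    then show ?thesis using n(2) sx by metis
  qed
  then have "left_asymptotic x' x" unfolding left_asymptotic_def by blast
  moreover have "\<pi> x' = y"
  proof
    fix j
    have "j \<in> {- int (nat \<bar>j\<bar>)..int (nat \<bar>j\<bar>)}" by auto
    then obtain n where n: "n \<ge> nat \<bar>j\<bar>" "\<pi> (s n) j = \<pi> x' j" using lim by blast
    then have "j \<ge> - int n" by linarith
    then show "\<pi> x' j = y j" using n(2) sy by metis
  qed
  ultimately show ?thesis using x' by blast
qed

end

theorem theorem4p1:
  fixes A :: "'a set" and B :: "'b set"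
    and X :: "(int \<Rightarrow> 'a) set" and Y :: "(int \<Rightarrow> 'b) set"
    and \<pi> :: "(int \<Rightarrow> 'a) \<Rightarrow> (int \<Rightarrow> 'b)"
  assumes "shift_of_finite_type A X" and "irreducible_shift X"
    and "shift_of_finite_type B Y"
    and "factor_code A X B Y \<pi>"
    and "right_class_closing X \<pi>"
  shows "right_continuing X Y \<pi>"
proof -
  have X: "shift_space A X" and Y: "shift_space B Y" and onto: "\<pi> ` X = Y"
    using assms(4) by (auto simp: factor_code_def)
  obtain kX :: nat where kX: "\<And>x x' i. \<lbrakk>x \<in> X; x' \<in> X; \<forall>j\<in>{i..<i + int kX}. x j = x' j\<rbrakk>
      \<Longrightarrow> join_at i x x' \<in> X"
    using sft_join[OF assms(1)] by blast
  obtain kY :: nat where kY: "\<And>y y' i. \<lbrakk>y \<in> Y; y' \<in> Y; \<forall>j\<in>{i..<i + int kY}. y j = y' j\<rbrakk>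
      \<Longrightarrow> join_at i y y' \<in> Y"
    using sft_join[OF assms(3)] by blast
  obtain r :: nat where r: "\<And>x x' i. \<lbrakk>x \<in> X; x' \<in> X; \<forall>j\<in>{i - int r..i + int r}. x j = x' j\<rbrakk>
      \<Longrightarrow> \<pi> x i = \<pi> x' i"
    using factor_code_local[OF assms(4)] by blast
  interpret class_closing_code A X \<pi> "kX + 2 * r" r
  proof
    show "join_at i x x' \<in> X" if "x \<in> X" "x' \<in> X" "\<forall>j\<in>{i..<i + int (kX + 2 * r)}. x j = x' j" for x x' i
      using that by (intro kX) auto
    show "\<pi> (translate t x) = translate t (\<pi> x)" if "x \<in> X" for x t
      by (rule factor_code_translate[OF assms(4) that])
    show "\<pi> x i = \<pi> x' i" if "x \<in> X" "x' \<in> X" "\<forall>j\<in>{i - int r..i + int r}. x j = x' j" for x x' i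
      using that by (rule r)
    show "shift_space A X" by (rule X)
    show "right_class_closing X \<pi>" by (rule assms(5))
  qed simp
  show ?thesis
    unfolding right_continuing_def
  proof (intro ballI impI)
    fix x y assume x: "x \<in> X" and y: "y \<in> Y" and "left_asymptotic y (\<pi> x)"
    then obtain n where n: "\<forall>i\<le>n. y i = \<pi> x i" unfolding left_asymptotic_def by blast
    have "\<exists>x'\<in>X. \<pi> x' = translate n y \<and> left_asymptotic x' (translate n x)"
    proof (rule right_continuing_at_0[OF assms(2)])
      show "translate t y \<in> \<pi> ` X" if "y \<in> \<pi> ` X" for y t
        using that onto shift_space_translate[OF Y] by simp
      show "join_at i y y' \<in> \<pi> ` X" if "y \<in> \<pi> ` X" "y' \<in> \<pi> ` X" "\<forall>j\<in>{i..<i + int kY}. y j = y' j" for y y' i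
        using that onto kY by simp
      show "translate n x \<in> X" by (rule translate_mem[OF x])
      show "translate n y \<in> \<pi> ` X" using onto shift_space_translate[OF Y y] by simp
      show "\<forall>j\<le>0. translate n y j = \<pi> (translate n x) j"
        using n by (simp add: code_translate[OF x])
    qed
    then obtain x' m where x': "x' \<in> X" "\<pi> x' = translate n y" "\<forall>j\<le>m. x' j = translate n x j"
      unfolding left_asymptotic_def by blast
    show "\<exists>x'\<in>X. \<pi> x' = y \<and> left_asymptotic x' x"
    proof (intro bexI[of _ "translate (- n) x'"] conjI)
      show "translate (- n) x' \<in> X" by (rule translate_mem[OF x'(1)])
      show "\<pi> (translate (- n) x') = y" unfolding code_translate[OF x'(1)] x'(2) by simp
      show "left_asymptotic (translate (- n) x') x"
        unfolding left_asymptotic_def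
        using x'(3) by (intro exI[of _ "m + n"]) auto
    qed
  qed
qed

end
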